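(* Let $n\ge2$, let $F^\alpha,F^\beta$ be two Minkowski norms on $\mathbb{R}^n$, let $A\neq B$ be points of $\mathbb{R}^n$, and let $\mathcal{T}(p)=F^\alpha(p-A)+F^\beta(B-p)$ for $p\in\mathbb{R}^n$. Let $\varphi$ be the curve of candidate tack points from $A$ to $B$. Then the global minimum of $\mathcal{T}\circ\varphi$ always exists and is an optimal tack point (that is, $\mathcal{T}\circ\varphi$ attains its minimum, and any point of $\varphi$ at which it is attained is a point where $\mathcal{T}$ attains its global minimum over $\mathbb{R}^n$).
   Context: A Minkowski norm (constant Finsler metric) on $\mathbb{R}^n$ is a continuous function $F:\mathbb{R}^n\to[0,\infty)$, positive and smooth away from $0$, positively homogeneous of degree 1 (not necessarily symmetric), whose indicatrix $\{v:F(v)=1\}$ is strongly convex (the Hessian of $\frac12F^2$ is positive definite at every $v\ne0$). One travels from $A$ to a single tack point $p$ with velocity given by the indicatrix $\Sigma^\alpha$ of $F^\alpha$, then from $p$ to $B$ with velocity given by the indicatrix $\Sigma^\beta$ of $F^\beta$, along straight segments; the total travel time is $\mathcal{T}(p)=F^\alpha(p-A)+F^\beta(B-p)$. An optimal tack point is a point $p\in\mathbb{R}^n$ where $\mathcal{T}$ attains its global minimum. Let $F^{\beta^-}(v)=F^\beta(-v)$ be the reverse metric. The wavefront of $F^\alpha$ from $A$ at time $\tau$ is $\mathcal{W}^\alpha_\tau=\{x:F^\alpha(x-A)=\tau\}$, and the wavefront of $F^{\beta^-}$ from $B$ at time $\sigma$ is $\{x:F^{\beta^-}(x-B)=\sigma\}$.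 The curve of candidate tack points is the unique curve from $A$ to $B$ formed by the points where a wavefront of $F^\alpha$ from $A$ is tangential to a wavefront of $F^{\beta^-}$ from $B$ (tangential from outside: the regions they enclose have disjoint interiors; the endpoints $A$, $B$ correspond to the degenerate wavefronts at time $0$). It is parametrized by the tacking time $\tau\in[0,T]$, $T=F^\alpha(B-A)$, so that $\varphi(\tau)\in\mathcal{W}^\alpha_\tau$. *)

theory Defs
  imports "HOL-Analysis.Analysis"
begin

text \<open>Smoothness on an open set via iterated directional derivatives: a function is
  \<open>C\<^sup>k\<^sup>+\<^sup>1\<close> iff it is differentiable and all its directional derivatives are \<open>C\<^sup>k\<close>.\<close>

fun C_times_diff_on :: "nat \<Rightarrow> ('a::euclidean_space \<Rightarrow> real) \<Rightarrow> 'a set \<Rightarrow> bool" where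
  "C_times_diff_on 0 f S \<longleftrightarrow> continuous_on S f"
| "C_times_diff_on (Suc k) f S \<longleftrightarrow>
     (\<forall>x\<in>S. f differentiable (at x)) \<and>
     (\<forall>v. C_times_diff_on k (\<lambda>x. frechet_derivative f (at x) v) S)"

definition smooth_on_open :: "('a::euclidean_space \<Rightarrow> real) \<Rightarrow> 'a set \<Rightarrow> bool" where
  "smooth_on_open f S \<longleftrightarrow> open S \<and> (\<forall>k. C_times_diff_on k f S)"

definition hessian :: "('a::euclidean_space \<Rightarrow> real) \<Rightarrow> 'a \<Rightarrow> 'a \<Rightarrow> 'a \<Rightarrow> real" where
  "hessian f x u w =
     frechet_derivative (\<lambda>y. frechet_derivative f (at y) u) (at x) w"

definition minkowski_norm :: "('a::euclidean_space \<Rightarrow> real) \<Rightarrow> bool" where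
  "minkowski_norm F \<longleftrightarrow>
     continuous_on UNIV F \<and>
     (\<forall>v. 0 \<le> F v) \<and>
     (\<forall>v. v \<noteq> 0 \<longrightarrow> 0 < F v) \<and>
     smooth_on_open F (- {0}) \<and>
     (\<forall>c v. 0 < c \<longrightarrow> F (c *\<^sub>R v) = c * F v) \<and>
     (\<forall>v u. v \<noteq> 0 \<longrightarrow> u \<noteq> 0 \<longrightarrow> 0 < hessian (\<lambda>x. (1/2) * (F x)\<^sup>2) v u u)"

definition reverse_metric :: "('a::euclidean_space \<Rightarrow> real) \<Rightarrow> 'a \<Rightarrow> real" where
  "reverse_metric F v = F (- v)"

definition wavefront :: "('a::euclidean_space \<Rightarrow> real) \<Rightarrow> 'a \<Rightarrow> real \<Rightarrow> 'a set" where
  "wavefront F A \<tau> = {x. F (x - A) = \<tau>}"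

definition wavefront_region :: "('a::euclidean_space \<Rightarrow> real) \<Rightarrow> 'a \<Rightarrow> real \<Rightarrow> 'a set" where
  "wavefront_region F A \<tau> = {x. F (x - A) \<le> \<tau>}"

text \<open>Only meaningful for \<open>x \<noteq> A\<close>: there the wavefront through \<open>x\<close> is a regular level set, whose
  tangent space is the kernel of the differential.\<close>

definition wavefront_tangent_space ::
    "('a::euclidean_space \<Rightarrow> real) \<Rightarrow> 'a \<Rightarrow> 'a \<Rightarrow> 'a set" where
  "wavefront_tangent_space F A x = {u. frechet_derivative (\<lambda>y. F (y - A)) (at x) u = 0}"

text \<open>A wavefront at time \<open>0\<close> is a single point and has no tangent hyperplane, so the condition on
  tangent spaces applies only when both times are positive.\<close>

definition externally_tangential_at ::
    "('a::euclidean_space \<Rightarrow> real) \<Rightarrow> 'a \<Rightarrow> real \<Rightarrow> ('a \<Rightarrow> real) \<Rightarrow> 'a \<Rightarrow> real \<Rightarrow> 'a \<Rightarrow> bool" where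
  "externally_tangential_at F A \<tau> G B \<sigma> p \<longleftrightarrow>
     p \<in> wavefront F A \<tau> \<and> p \<in> wavefront G B \<sigma> \<and>
     (0 < \<tau> \<and> 0 < \<sigma> \<longrightarrow> wavefront_tangent_space F A p = wavefront_tangent_space G B p) \<and>
     interior (wavefront_region F A \<tau>) \<inter> interior (wavefront_region G B \<sigma>) = {}"

text \<open>The curve is parametrized by the tacking time, so \<open>\<phi> \<tau>\<close> lies on the wavefront of
  \<open>F\<alpha>\<close> at time \<open>\<tau>\<close>. That the points with these properties are unique, and that
  \<open>\<phi>\<close> therefore passes through every point of tangency, is a consequence of strong convexity
  and not part of the definition. Values of \<open>\<phi>\<close> outside the parameter interval are irrelevant.\<close>

definition candidate_tack_curve ::
    "('a::euclidean_space \<Rightarrow> real) \<Rightarrow> ('a \<Rightarrow> real) \<Rightarrow> 'a \<Rightarrow> 'a \<Rightarrow> (real \<Rightarrow> 'a) \<Rightarrow> bool" where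
  "candidate_tack_curve F\<alpha> F\<beta> A B \<phi> \<longleftrightarrow>
     continuous_on {0..F\<alpha> (B - A)} \<phi> \<and>
     \<phi> 0 = A \<and> \<phi> (F\<alpha> (B - A)) = B \<and>
     (\<forall>\<tau>\<in>{0..F\<alpha> (B - A)}. \<exists>\<sigma>\<ge>0.
        externally_tangential_at F\<alpha> A \<tau> (reverse_metric F\<beta>) B \<sigma> (\<phi> \<tau>))"

definition travel_time ::
    "('a::euclidean_space \<Rightarrow> real) \<Rightarrow> ('a \<Rightarrow> real) \<Rightarrow> 'a \<Rightarrow> 'a \<Rightarrow> 'a \<Rightarrow> real" where
  "travel_time F\<alpha> F\<beta> A B p = F\<alpha> (p - A) + F\<beta> (B - p)"

definition optimal_tack_point ::
    "('a::euclidean_space \<Rightarrow> real) \<Rightarrow> ('a \<Rightarrow> real) \<Rightarrow> 'a \<Rightarrow> 'a \<Rightarrow> 'a \<Rightarrow> bool" where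
  "optimal_tack_point F\<alpha> F\<beta> A B p \<longleftrightarrow>
     (\<forall>q. travel_time F\<alpha> F\<beta> A B p \<le> travel_time F\<alpha> F\<beta> A B q)"

end

theory Submission
  imports Defs
begin

text \<open>A point \<open>q\<close> with \<open>F\<alpha> (q - A) \<ge> T\<close> is no better than \<open>B\<close>. Otherwise \<open>q\<close> lies on the
  wavefront of \<open>F\<alpha>\<close> at some time \<open>t < T\<close>, which touches at \<open>\<phi> t\<close> a reverse wavefront from \<open>B\<close>.
  If \<open>q\<close> were strictly inside that reverse wavefront, then moving \<open>q\<close> slightly towards \<open>A\<close> would
  give a point interior to both regions; hence \<open>\<phi> t\<close> is at least as good as \<open>q\<close>. So every point of
  the space is dominated by a point of the compact curve.\<close>

lemma minkowski_norm_zero: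
  assumes "minkowski_norm F"
  shows "F 0 = 0"
proof -
  have "\<forall>c v. 0 < c \<longrightarrow> F (c *\<^sub>R v) = c * F v"
    using assms unfolding minkowski_norm_def by blast
  \<comment> \<open>Homogeneity is available for positive factors; the factor 2 turns it into
    \<open>F 0 = 2 * F 0\<close>.\<close>
  from this[rule_format, of 2 0] show ?thesis by simp
qed

lemma open_sublevel_subset_interior_wavefront_region:
  assumes "continuous_on UNIV F"
  shows "{x. F (x - A) < \<tau>} \<subseteq> interior (wavefront_region F A \<tau>)"
proof (rule interior_maximal)
  have "continuous_on UNIV (\<lambda>x. F (x - A))"
    by (rule continuous_on_compose2[OF assms]) (auto intro!: continuous_intros)
  then show "open {x. F (x - A) < \<tau>}"
    by (rule open_Collect_less) (rule continuous_on_const)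
qed (auto simp: wavefront_region_def)

text \<open>The contradiction comes from the disjointness of the interiors. Since \<open>q\<close>
  itself satisfies only \<open>F (q - A) = \<tau>\<close>, it is first pushed towards
  \<open>A\<close> to make this inequality strict as well.\<close>

lemma externally_tangential_at_le:
  assumes "minkowski_norm F" and "continuous_on UNIV G"
    and tang: "externally_tangential_at F A \<tau> G B \<sigma> p"
    and "0 < \<tau>" and q: "F (q - A) = \<tau>"
  shows "\<sigma> \<le> G (q - B)"
proof (rule ccontr)
  assume "\<not> \<sigma> \<le> G (q - B)"
  have contF: "continuous_on UNIV F" and hom: "\<And>c v. 0 < c \<Longrightarrow> F (c *\<^sub>R v) = c * F v"
    using assms(1) unfolding minkowski_norm_def by blast+
  \<comment> \<open>The ray from \<open>A\<close> through \<open>q\<close>, with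
    \<open>x 1 = q\<close>. By homogeneity \<open>F (x c - A) = c * \<tau>\<close> for
    \<open>c > 0\<close>, which is below \<open>\<tau>\<close> as soon as
    \<open>c < 1\<close>.\<close>
  define x where "x = (\<lambda>c::real. A + c *\<^sub>R (q - A))"
  have "continuous_on UNIV (\<lambda>c. G (x c - B))"
    unfolding x_def
    by (rule continuous_on_compose2[OF assms(2)]) (auto intro!: continuous_intros)
  \<comment> \<open>The limit is taken from the left, so that the strict inequality for
    \<open>G\<close> at \<open>q\<close> persists at some \<open>c < 1\<close>.\<close>
  then have "((\<lambda>c. G (x c - B)) \<longlongrightarrow> G (x 1 - B)) (at_left 1)"
    using tendsto_within_subset[OF _ subset_UNIV] unfolding continuous_on_def by blast
  moreover have "G (x 1 - B) < \<sigma>"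
    using \<open>\<not> \<sigma> \<le> G (q - B)\<close> by (simp add: x_def)
  ultimately have "\<forall>\<^sub>F c in at_left 1. G (x c - B) < \<sigma>"
    by (rule order_tendstoD)
  moreover have "\<forall>\<^sub>F c::real in at_left 1. c \<in> {0<..<1}"
    by (rule eventually_at_left_real) simp
  ultimately have "\<exists>c. G (x c - B) < \<sigma> \<and> c \<in> {0<..<1}"
    by (intro eventually_happens'[OF trivial_limit_at_left_real] eventually_conj)
  then obtain c where "G (x c - B) < \<sigma>" "0 < c" "c < 1" by auto
  moreover have "F (x c - A) < \<tau>"
    using hom[OF \<open>0 < c\<close>, of "q - A"] q \<open>0 < \<tau>\<close> \<open>c < 1\<close> by (simp add: x_def)
  ultimately have "x c \<in> interior (wavefront_region F A \<tau>) \<inter> interior (wavefront_region G B \<sigma>)"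
    using open_sublevel_subset_interior_wavefront_region[OF contF]
      open_sublevel_subset_interior_wavefront_region[OF assms(2)] by blast
  then show False
    using tang unfolding externally_tangential_at_def by blast
qed

text \<open>The parameter \<open>s\<close> is the travel time from \<open>A\<close> to
  \<open>q\<close>, cut off at \<open>F\<alpha> (B - A)\<close>. Below the cutoff the first legs to
  \<open>q\<close> and to \<open>\<phi> s\<close> take equally long, so only the second legs need
  comparing.\<close>

lemma candidate_tack_curve_dominates:
  assumes F\<alpha>: "minkowski_norm F\<alpha>" and F\<beta>: "minkowski_norm F\<beta>"
    and curve: "candidate_tack_curve F\<alpha> F\<beta> A B \<phi>"
  shows "\<exists>s\<in>{0..F\<alpha> (B - A)}. travel_time F\<alpha> F\<beta> A B (\<phi> s) \<le> travel_time F\<alpha> F\<beta> A B q"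
proof -
  have nonneg: "0 \<le> F\<alpha> v" "0 \<le> F\<beta> v" and pos: "v \<noteq> 0 \<Longrightarrow> 0 < F\<alpha> v" for v
    using F\<alpha> F\<beta> by (simp_all add: minkowski_norm_def)
  have ends: "\<phi> 0 = A" "\<phi> (F\<alpha> (B - A)) = B"
    using curve unfolding candidate_tack_curve_def by blast+
  \<comment> \<open>In the first case the first leg to \<open>q\<close> alone takes at least as long
    as the whole trip with tack point \<open>B\<close>. The point \<open>A\<close> is separate
    because the comparison of second legs requires a positive tacking time.\<close>
  consider "F\<alpha> (B - A) \<le> F\<alpha> (q - A)" | "q = A" | "q \<noteq> A" "F\<alpha> (q - A) < F\<alpha> (B - A)"
    by linarith
  then show ?thesis
  proof cases
    case 1
    have "travel_time F\<alpha> F\<beta> A B B \<le> travel_time F\<alpha> F\<beta> A B q"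
      using 1 nonneg(2)[of "B - q"] minkowski_norm_zero[OF F\<beta>] by (simp add: travel_time_def)
    then show ?thesis
      using ends(2) nonneg(1) by (intro bexI[of _ "F\<alpha> (B - A)"]) auto
  next
    case 2
    then show ?thesis
      using ends(1) nonneg(1) by (intro bexI[of _ 0]) auto
  next
    case 3
    define t where "t = F\<alpha> (q - A)"
    have t: "0 < t" "t \<in> {0..F\<alpha> (B - A)}"
      using 3 pos[of "q - A"] by (auto simp: t_def)
    then obtain \<sigma> where tang:
      "externally_tangential_at F\<alpha> A t (reverse_metric F\<beta>) B \<sigma> (\<phi> t)"
      using curve unfolding candidate_tack_curve_def by blast
    have "continuous_on UNIV F\<beta>"
      using F\<beta> unfolding minkowski_norm_def by blast
    then have "continuous_on UNIV (reverse_metric F\<beta>)"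
      unfolding reverse_metric_def
      by (rule continuous_on_compose2) (auto intro!: continuous_intros)
    then have "\<sigma> \<le> F\<beta> (B - q)"
      using externally_tangential_at_le[OF F\<alpha> _ tang t(1)]
      by (simp add: t_def reverse_metric_def)
    moreover have "F\<alpha> (\<phi> t - A) = t" "F\<beta> (B - \<phi> t) = \<sigma>"
      using tang by (simp_all add: externally_tangential_at_def wavefront_def reverse_metric_def)
    ultimately show ?thesis
      using t(2) by (intro bexI[of _ t]) (simp_all add: travel_time_def t_def)
  qed
qed

theorem theorem5p5:
  fixes F\<alpha> F\<beta> :: "real ^ 'n \<Rightarrow> real"
    and A B :: "real ^ 'n"
    and \<phi> :: "real \<Rightarrow> real ^ 'n"
  assumes "CARD('n) \<ge> 2"
    and "minkowski_norm F\<alpha>"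
    and "minkowski_norm F\<beta>"
    and "A \<noteq> B"
    and "candidate_tack_curve F\<alpha> F\<beta> A B \<phi>"
  shows "(\<exists>\<tau>\<in>{0..F\<alpha> (B - A)}. \<forall>s\<in>{0..F\<alpha> (B - A)}.
            travel_time F\<alpha> F\<beta> A B (\<phi> \<tau>) \<le> travel_time F\<alpha> F\<beta> A B (\<phi> s)) \<and>
         (\<forall>\<tau>\<in>{0..F\<alpha> (B - A)}.
            (\<forall>s\<in>{0..F\<alpha> (B - A)}.
               travel_time F\<alpha> F\<beta> A B (\<phi> \<tau>) \<le> travel_time F\<alpha> F\<beta> A B (\<phi> s))
            \<longrightarrow> optimal_tack_point F\<alpha> F\<beta> A B (\<phi> \<tau>))"
proof (intro conjI ballI impI)
  let ?T = "F\<alpha> (B - A)"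
  have cont: "continuous_on UNIV F\<alpha>" "continuous_on UNIV F\<beta>" and T: "0 \<le> ?T"
    using assms(2,3) by (simp_all add: minkowski_norm_def)
  have cont\<phi>: "continuous_on {0..?T} \<phi>"
    using assms(5) unfolding candidate_tack_curve_def by blast
  have "continuous_on {0..?T} (\<lambda>s. travel_time F\<alpha> F\<beta> A B (\<phi> s))"
    unfolding travel_time_def
    by (intro continuous_on_add continuous_on_compose2[OF cont(1)] continuous_on_compose2[OF cont(2)]
        continuous_on_diff continuous_on_const cont\<phi>) auto
  then show "\<exists>\<tau>\<in>{0..?T}. \<forall>s\<in>{0..?T}.
      travel_time F\<alpha> F\<beta> A B (\<phi> \<tau>) \<le> travel_time F\<alpha> F\<beta> A B (\<phi> s)"
    using T by (intro continuous_attains_inf) auto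
next
  fix \<tau>
  assume "\<forall>s\<in>{0..F\<alpha> (B - A)}. travel_time F\<alpha> F\<beta> A B (\<phi> \<tau>) \<le> travel_time F\<alpha> F\<beta> A B (\<phi> s)"
  \<comment> \<open>Any \<open>q\<close> is dominated by some \<open>\<phi> s\<close>, which in turn
    is dominated by the minimizer \<open>\<phi> \<tau>\<close> along the curve.\<close>
  then show "optimal_tack_point F\<alpha> F\<beta> A B (\<phi> \<tau>)"
    unfolding optimal_tack_point_def
    using candidate_tack_curve_dominates[OF assms(2,3,5)] order_trans by blast
qed

end
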